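(* Let $(M,\omega^M,\mu)$ and $(M',\omega_{M'},\mu')$ be the closed six-dimensional semi-free Hamiltonian $S^1$-manifolds constructed in the context. Then $M$ and $M'$ are not equivariantly symplectomorphic. In fact, they are not even $\mu$-$S^1$-diffeomorphic: there is no $S^1$-equivariant diffeomorphism $M\to M'$ intertwining $\mu$ and $\mu'$.
   Context: Convention: a momentum map satisfies $d\mu=-\omega(\xi,\cdot)$, $\xi$ the fundamental vector field. Construction of $M$. Let $\varepsilon>0$, and let $\omega$ be the Fubini-Study form on $S^2$. Let $N=S^2\times S^2$ with symplectic form $((1+\varepsilon)\omega,\omega)$ and the standard product $T^2=S^1\times S^1$-action $\rho_1$ by rotations; restrict to the diagonal circle to obtain an $S^1$-action on $N$ with momentum map $\mu_N$. Its fixed points are the four points $(a,b)$, $a,b\in\{\text{southpole},\text{northpole}\}$, with $\mu_N$ minimal at (southpole, southpole) and maximal at (northpole, northpole); the interior critical values are $\lambda=\mu_N(\text{southpole},\text{northpole})<\lambda'=\mu_N(\text{northpole},\text{southpole})$. Let $M=N\times S^2$ with $\omega^M=((1+\varepsilon)\omega,\omega,\omega)$, with $S^1$ acting on $N$ by the diagonal circle action $s\mapsto\rho_1(s,s)$ and trivially on the last factor, and momentum map $\mu$ (the pullback of $\mu_N$). This action is semi-free and its fixed components are the four spheres $\{a\}\times\{b\}\times S^2$. Construction of $M'$. Let $N'=\mu_N^{-1}((\lambda,\lambda'))$ and let $\rho_2$ be the $T^2$-action on $N'$ given by $\rho_2(a,b)=\rho_1(a,ab)$, i.e. $\rho_2=\rho_1\circ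 A$ with $A=\begin{pmatrix}1&0\\1&1\end{pmatrix}$; the circle $S^1\times\{e\}$ acts via $\rho_2$ as the diagonal circle action $s\mapsto\rho_1(s,s)$. By the classification of non-compact symplectic toric manifolds, $(N',\rho_2)$ is $T^2$-equivariantly symplectomorphic to $((\lambda,\lambda')\times S^1)\times S^2$ with the form $(dt\wedge d\varphi,\omega)$ and the standard $T^2$-action (the first circle rotating the $S^1$ factor, the second rotating $S^2$), with $\mu_N$ corresponding to the coordinate $t$. Hence $U:=\mu^{-1}((\lambda,\lambda'))=N'\times S^2$ is identified, as a Hamiltonian $S^1$-manifold, with $((\lambda,\lambda')\times S^1)\times S^2\times S^2$ with form $(dt\wedge d\varphi,\omega,\omega)$, $S^1$ rotating the $S^1$ factor, and momentum map $t$. Let $g^{\mathrm{swap}}_U\colon U\to U$ be the equivariant, momentum-map-preserving symplectomorphism $(t,\varphi,p_1,p_2)\mapsto(t,\varphi,p_2,p_1)$. Put $M_-=\mu^{-1}((-\infty,\lambda'))$ and $M_+=\mu^{-1}((\lambda,\infty))$ (so $M_-\cap M_+=U$) and $$M'=(M_-\sqcup M_+)/\!\sim,\qquad x\sim y \iff x\in U\subset M_-,\ y\in U\subset M_+,\ g^{\mathrm{swap}}_U(x)=y.$$ The symplectic forms, circle actions and momentum maps on $M_\pm$ (restricted from $M$) induce a symplectic form $\omega_{M'}$, a semi-free Hamiltonian $S^1$-action and a momentum map $\mu'$ on $M'$. *)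

theory Defs
  imports "HOL-Analysis.Analysis"
begin

section \<open>Smooth maps between subsets of Euclidean spaces\<close>

primrec Ck_on :: "nat \<Rightarrow> 'a::euclidean_space set \<Rightarrow> ('a \<Rightarrow> 'b::euclidean_space) \<Rightarrow> bool" where
  "Ck_on 0 U f \<longleftrightarrow> continuous_on U f"
| "Ck_on (Suc k) U f \<longleftrightarrow> (\<forall>x\<in>U. f differentiable (at x)) \<and>
     (\<forall>v. Ck_on k U (\<lambda>x. frechet_derivative f (at x) v))"

text \<open>The set \<open>S\<close> need not be open: a map on \<open>S\<close> is smooth if it locally extends to a
  \<open>C\<^sup>\<infinity>\<close> map on an open subset of the ambient space. For an embedded submanifold this is
  smoothness in charts.\<close>

definition smooth_on :: "'a::euclidean_space set \<Rightarrow> ('a \<Rightarrow> 'b::euclidean_space) \<Rightarrow> bool" where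
  "smooth_on S f \<longleftrightarrow> (\<forall>x\<in>S. \<exists>U g. open U \<and> x \<in> U \<and> (\<forall>k. Ck_on k U g) \<and>
     (\<forall>y\<in>S \<inter> U. g y = f y))"

text \<open>The curve is only required to be differentiable at \<open>0\<close>; for an embedded submanifold its
  velocities there are exactly the tangent vectors.\<close>

definition tangent_space :: "'a::euclidean_space set \<Rightarrow> 'a \<Rightarrow> 'a set" where
  "tangent_space P p = {v. \<exists>c :: real \<Rightarrow> 'a. c 0 = p \<and> (\<forall>t. c t \<in> P) \<and>
     (c has_vector_derivative v) (at 0)}"


section \<open>Manifolds with a two-form, given by an atlas of embedded patches\<close>

text \<open>A manifold is presented by patches \<open>patch X i\<close>, which are embedded submanifolds of a Euclidean
  space (not necessarily open in it), together with injective parametrisations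
  \<open>glue X i\<close> of open subsets of the manifold. The two-form is given in each patch, as a function of
  the base point and two tangent vectors. The records only carry the data; the laws hold for
  the instances constructed below.\<close>

record ('i, 'e, 'x) form_manifold =
  idx :: "'i set"
  patch :: "'i \<Rightarrow> 'e set"
  glue :: "'i \<Rightarrow> 'e \<Rightarrow> 'x"
  form :: "'i \<Rightarrow> 'e \<Rightarrow> 'e \<Rightarrow> 'e \<Rightarrow> real"

record ('i, 'e, 'x) S1_manifold = "('i, 'e, 'x) form_manifold" +
  act :: "complex \<Rightarrow> 'x \<Rightarrow> 'x"
  mom :: "'x \<Rightarrow> real"

definition points :: "('i, 'e, 'x, 'm) form_manifold_scheme \<Rightarrow> 'x set" where
  "points X = (\<Union>i\<in>idx X. glue X i ` patch X i)"

definition rep_dom ::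
  "('i, 'e, 'x, 'm) form_manifold_scheme \<Rightarrow> ('j, 'f, 'y, 'n) form_manifold_scheme \<Rightarrow>
   ('x \<Rightarrow> 'y) \<Rightarrow> 'i \<Rightarrow> 'j \<Rightarrow> 'e set" where
  "rep_dom X Y F i j = {p \<in> patch X i. F (glue X i p) \<in> glue Y j ` patch Y j}"

definition local_rep ::
  "('i, 'e, 'x, 'm) form_manifold_scheme \<Rightarrow> ('j, 'f, 'y, 'n) form_manifold_scheme \<Rightarrow>
   ('x \<Rightarrow> 'y) \<Rightarrow> 'i \<Rightarrow> 'j \<Rightarrow> 'e \<Rightarrow> 'f" where
  "local_rep X Y F i j p = inv_into (patch Y j) (glue Y j) (F (glue X i p))"

text \<open>Openness of the domains of the local representatives expresses continuity.\<close>

definition smooth_map ::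
  "('i, 'e::euclidean_space, 'x, 'm) form_manifold_scheme \<Rightarrow>
   ('j, 'f::euclidean_space, 'y, 'n) form_manifold_scheme \<Rightarrow> ('x \<Rightarrow> 'y) \<Rightarrow> bool" where
  "smooth_map X Y F \<longleftrightarrow> F ` points X \<subseteq> points Y \<and>
     (\<forall>i\<in>idx X. \<forall>j\<in>idx Y.
        openin (top_of_set (patch X i)) (rep_dom X Y F i j) \<and>
        smooth_on (rep_dom X Y F i j) (local_rep X Y F i j))"

definition diffeomorphism ::
  "('i, 'e::euclidean_space, 'x, 'm) form_manifold_scheme \<Rightarrow>
   ('j, 'f::euclidean_space, 'y, 'n) form_manifold_scheme \<Rightarrow> ('x \<Rightarrow> 'y) \<Rightarrow> bool" where
  "diffeomorphism X Y F \<longleftrightarrow> bij_betw F (points X) (points Y) \<and>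
     smooth_map X Y F \<and> smooth_map Y X (inv_into (points X) F)"

text \<open>A derivative \<open>D\<close> within an embedded submanifold is determined on tangent vectors only, which
  is where it is used.\<close>

definition preserves_form ::
  "('i, 'e::euclidean_space, 'x, 'm) form_manifold_scheme \<Rightarrow>
   ('j, 'f::euclidean_space, 'y, 'n) form_manifold_scheme \<Rightarrow> ('x \<Rightarrow> 'y) \<Rightarrow> bool" where
  "preserves_form X Y F \<longleftrightarrow>
     (\<forall>i\<in>idx X. \<forall>j\<in>idx Y. \<forall>p\<in>rep_dom X Y F i j. \<forall>D.
        (local_rep X Y F i j has_derivative D) (at p within rep_dom X Y F i j) \<longrightarrow>
        (\<forall>v\<in>tangent_space (patch X i) p. \<forall>w\<in>tangent_space (patch X i) p.
           form Y j (local_rep X Y F i j p) (D v) (D w) = form X i p v w))"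

definition symplectomorphism ::
  "('i, 'e::euclidean_space, 'x, 'm) form_manifold_scheme \<Rightarrow>
   ('j, 'f::euclidean_space, 'y, 'n) form_manifold_scheme \<Rightarrow> ('x \<Rightarrow> 'y) \<Rightarrow> bool" where
  "symplectomorphism X Y F \<longleftrightarrow> diffeomorphism X Y F \<and> preserves_form X Y F"

definition S1 :: "complex set" where
  "S1 = sphere 0 1"

definition S1_equivariant ::
  "('i, 'e, 'x, 'm) S1_manifold_scheme \<Rightarrow> ('j, 'f, 'y, 'n) S1_manifold_scheme \<Rightarrow>
   ('x \<Rightarrow> 'y) \<Rightarrow> bool" where
  "S1_equivariant X Y F \<longleftrightarrow> (\<forall>s\<in>S1. \<forall>x\<in>points X. F (act X s x) = act Y s (F x))"

definition equivariantly_symplectomorphic ::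
  "('i, 'e::euclidean_space, 'x, 'm) S1_manifold_scheme \<Rightarrow>
   ('j, 'f::euclidean_space, 'y, 'n) S1_manifold_scheme \<Rightarrow> bool" where
  "equivariantly_symplectomorphic X Y \<longleftrightarrow>
     (\<exists>F. symplectomorphism X Y F \<and> S1_equivariant X Y F)"

definition mu_S1_diffeomorphic ::
  "('i, 'e::euclidean_space, 'x, 'm) S1_manifold_scheme \<Rightarrow>
   ('j, 'f::euclidean_space, 'y, 'n) S1_manifold_scheme \<Rightarrow> bool" where
  "mu_S1_diffeomorphic X Y \<longleftrightarrow>
     (\<exists>F. diffeomorphism X Y F \<and> S1_equivariant X Y F \<and>
          (\<forall>x\<in>points X. mom Y (F x) = mom X x))"

definition embedded ::
  "'e::euclidean_space set \<Rightarrow> ('e \<Rightarrow> 'e \<Rightarrow> 'e \<Rightarrow> real) \<Rightarrow> (unit, 'e, 'e) form_manifold" where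
  "embedded P \<omega> = \<lparr>idx = UNIV, patch = (\<lambda>_. P), glue = (\<lambda>_ p. p), form = (\<lambda>_. \<omega>)\<rparr>"

definition fundamental_field ::
  "(complex \<Rightarrow> 'e \<Rightarrow> 'e) \<Rightarrow> 'e::euclidean_space \<Rightarrow> 'e" where
  "fundamental_field \<alpha> p = vector_derivative (\<lambda>\<theta>. \<alpha> (cis \<theta>) p) (at 0)"

text \<open>The sign convention is \<open>d\<mu> = - \<omega>(\<xi>, \<cdot>)\<close>.\<close>

definition momentum_map ::
  "'e::euclidean_space set \<Rightarrow> ('e \<Rightarrow> 'e \<Rightarrow> 'e \<Rightarrow> real) \<Rightarrow> (complex \<Rightarrow> 'e \<Rightarrow> 'e) \<Rightarrow>
   ('e \<Rightarrow> real) \<Rightarrow> bool" where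
  "momentum_map P \<omega> \<alpha> \<mu> \<longleftrightarrow> smooth_on P \<mu> \<and>
     (\<forall>p\<in>P. \<forall>D. (\<mu> has_derivative D) (at p within P) \<longrightarrow>
        (\<forall>v\<in>tangent_space P p. D v = - \<omega> p (fundamental_field \<alpha> p) v))"


section \<open>The manifold \<open>M\<close>\<close>

text \<open>Points of \<open>S\<^sup>2\<close> are pairs \<open>(z, h)\<close> of a complex number and a height with
  \<open>\<bar>z\<bar>\<^sup>2 + h\<^sup>2 = 1\<close>.\<close>

type_synonym R3 = "complex \<times> real"

definition S2 :: "R3 set" where
  "S2 = sphere 0 1"

definition southpole :: R3 where "southpole = (0, -1)"
definition northpole :: R3 where "northpole = (0, 1)"

definition rot :: "complex \<Rightarrow> R3 \<Rightarrow> R3" where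
  "rot s = (\<lambda>(z, h). (s * z, h))"

text \<open>The sphere is identified with the projective line by the stereographic coordinate
  \<open>\<zeta> = z / (1 - h)\<close>, in which the southpole is the origin. The form below is
  \<open>(i/2) d\<zeta> \<and> d\<zeta>*/(1 + \<bar>\<zeta>\<bar>\<^sup>2)\<^sup>2\<close> (where \<open>\<zeta>*\<close> is the conjugate), of total area \<open>\<pi>\<close>.
  In cylindrical coordinates it is \<open>(1/4) dh \<and> d\<phi>\<close>, that is, \<open>-1/4\<close> times the determinant of
  (point, first vector, second vector); the rotation \<open>rot\<close> has momentum map \<open>h/4\<close>, which is
  minimal at the southpole.\<close>

definition fubini_study :: "R3 \<Rightarrow> R3 \<Rightarrow> R3 \<Rightarrow> real" where
  "fubini_study = (\<lambda>(z, h) (a, k) (b, l).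
     (k * Im (cnj z * b) - l * Im (cnj z * a) - h * Im (cnj a * b)) / 4)"

definition N_set :: "(R3 \<times> R3) set" where
  "N_set = S2 \<times> S2"

definition omega_N :: "real \<Rightarrow> R3 \<times> R3 \<Rightarrow> R3 \<times> R3 \<Rightarrow> R3 \<times> R3 \<Rightarrow> real" where
  "omega_N \<epsilon> = (\<lambda>(p1, p2) (v1, v2) (w1, w2).
     (1 + \<epsilon>) * fubini_study p1 v1 w1 + fubini_study p2 v2 w2)"

definition rho1 :: "complex \<times> complex \<Rightarrow> R3 \<times> R3 \<Rightarrow> R3 \<times> R3" where
  "rho1 = (\<lambda>(a, b) (p1, p2). (rot a p1, rot b p2))"

definition diag_act :: "complex \<Rightarrow> R3 \<times> R3 \<Rightarrow> R3 \<times> R3" where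
  "diag_act s = rho1 (s, s)"

definition omega_M ::
  "real \<Rightarrow> (R3 \<times> R3) \<times> R3 \<Rightarrow> (R3 \<times> R3) \<times> R3 \<Rightarrow> (R3 \<times> R3) \<times> R3 \<Rightarrow> real" where
  "omega_M \<epsilon> = (\<lambda>(n, p) (v, v3) (w, w3). omega_N \<epsilon> n v w + fubini_study p v3 w3)"

definition act_M :: "complex \<Rightarrow> (R3 \<times> R3) \<times> R3 \<Rightarrow> (R3 \<times> R3) \<times> R3" where
  "act_M s = (\<lambda>(n, p). (diag_act s n, p))"

definition mu_M :: "(R3 \<times> R3 \<Rightarrow> real) \<Rightarrow> (R3 \<times> R3) \<times> R3 \<Rightarrow> real" where
  "mu_M \<mu>\<^sub>N = (\<lambda>(n, p). \<mu>\<^sub>N n)"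

definition M_set :: "((R3 \<times> R3) \<times> R3) set" where
  "M_set = N_set \<times> S2"

definition M_mfd ::
  "real \<Rightarrow> (R3 \<times> R3 \<Rightarrow> real) \<Rightarrow> (unit, (R3 \<times> R3) \<times> R3, (R3 \<times> R3) \<times> R3) S1_manifold" where
  "M_mfd \<epsilon> \<mu>\<^sub>N = form_manifold.extend (embedded M_set (omega_M \<epsilon>))
     (S1_manifold.fields act_M (mu_M \<mu>\<^sub>N))"


section \<open>The manifold \<open>M'\<close>\<close>

definition crit1 :: "(R3 \<times> R3 \<Rightarrow> real) \<Rightarrow> real" where
  "crit1 \<mu>\<^sub>N = \<mu>\<^sub>N (southpole, northpole)"

definition crit2 :: "(R3 \<times> R3 \<Rightarrow> real) \<Rightarrow> real" where
  "crit2 \<mu>\<^sub>N = \<mu>\<^sub>N (northpole, southpole)"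

definition N'_set :: "(R3 \<times> R3 \<Rightarrow> real) \<Rightarrow> (R3 \<times> R3) set" where
  "N'_set \<mu>\<^sub>N = {n \<in> N_set. crit1 \<mu>\<^sub>N < \<mu>\<^sub>N n \<and> \<mu>\<^sub>N n < crit2 \<mu>\<^sub>N}"

definition rho2 :: "complex \<times> complex \<Rightarrow> R3 \<times> R3 \<Rightarrow> R3 \<times> R3" where
  "rho2 = (\<lambda>(a, b). rho1 (a, a * b))"

definition model_set :: "(R3 \<times> R3 \<Rightarrow> real) \<Rightarrow> ((real \<times> complex) \<times> R3) set" where
  "model_set \<mu>\<^sub>N = ({crit1 \<mu>\<^sub>N <..< crit2 \<mu>\<^sub>N} \<times> S1) \<times> S2"

text \<open>\<open>dt \<and> d\<phi>\<close> on the cylinder plus the Fubini-Study form; on the unit circle,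
  \<open>d\<phi>\<close> at \<open>u\<close> maps a tangent vector \<open>a\<close> to \<open>Im (cnj u * a)\<close>.\<close>

definition model_form ::
  "(real \<times> complex) \<times> R3 \<Rightarrow> (real \<times> complex) \<times> R3 \<Rightarrow> (real \<times> complex) \<times> R3 \<Rightarrow> real" where
  "model_form = (\<lambda>((t, u), q) ((r, a), v) ((s, b), w).
     (r * Im (cnj u * b) - s * Im (cnj u * a)) + fubini_study q v w)"

definition model_act ::
  "complex \<times> complex \<Rightarrow> (real \<times> complex) \<times> R3 \<Rightarrow> (real \<times> complex) \<times> R3" where
  "model_act = (\<lambda>(a, b) ((t, u), q). ((t, a * u), rot b q))"

text \<open>The identifications of \<open>N'\<close> with the model provided by the classification of non-compact
  symplectic toric manifolds. One of them sends \<open>((z, h), p)\<close> to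
  \<open>((\<mu>\<^sub>N ((z, h), p), sgn z), rot (cnj (sgn z)) p)\<close>.\<close>

definition toric_identification ::
  "real \<Rightarrow> (R3 \<times> R3 \<Rightarrow> real) \<Rightarrow> (R3 \<times> R3 \<Rightarrow> (real \<times> complex) \<times> R3) \<Rightarrow> bool" where
  "toric_identification \<epsilon> \<mu>\<^sub>N \<Psi> \<longleftrightarrow>
     symplectomorphism (embedded (N'_set \<mu>\<^sub>N) (omega_N \<epsilon>))
       (embedded (model_set \<mu>\<^sub>N) model_form) \<Psi> \<and>
     (\<forall>a\<in>S1. \<forall>b\<in>S1. \<forall>n\<in>N'_set \<mu>\<^sub>N. \<Psi> (rho2 (a, b) n) = model_act (a, b) (\<Psi> n)) \<and>
     (\<forall>n\<in>N'_set \<mu>\<^sub>N. fst (fst (\<Psi> n)) = \<mu>\<^sub>N n)"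

definition U_set :: "(R3 \<times> R3 \<Rightarrow> real) \<Rightarrow> ((R3 \<times> R3) \<times> R3) set" where
  "U_set \<mu>\<^sub>N = {x \<in> M_set. crit1 \<mu>\<^sub>N < mu_M \<mu>\<^sub>N x \<and> mu_M \<mu>\<^sub>N x < crit2 \<mu>\<^sub>N}"

definition M_minus :: "(R3 \<times> R3 \<Rightarrow> real) \<Rightarrow> ((R3 \<times> R3) \<times> R3) set" where
  "M_minus \<mu>\<^sub>N = {x \<in> M_set. mu_M \<mu>\<^sub>N x < crit2 \<mu>\<^sub>N}"

definition M_plus :: "(R3 \<times> R3 \<Rightarrow> real) \<Rightarrow> ((R3 \<times> R3) \<times> R3) set" where
  "M_plus \<mu>\<^sub>N = {x \<in> M_set. crit1 \<mu>\<^sub>N < mu_M \<mu>\<^sub>N x}"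

text \<open>The swap \<open>(t, \<phi>, p\<^sub>1, p\<^sub>2) \<mapsto> (t, \<phi>, p\<^sub>2, p\<^sub>1)\<close>, transported to \<open>U\<close> along \<open>\<Psi> \<times> id\<close>.\<close>

definition g_swap ::
  "(R3 \<times> R3 \<Rightarrow> real) \<Rightarrow> (R3 \<times> R3 \<Rightarrow> (real \<times> complex) \<times> R3) \<Rightarrow>
   (R3 \<times> R3) \<times> R3 \<Rightarrow> (R3 \<times> R3) \<times> R3" where
  "g_swap \<mu>\<^sub>N \<Psi> = (\<lambda>(n, p2). case \<Psi> n of ((t, u), p1) \<Rightarrow>
     (inv_into (N'_set \<mu>\<^sub>N) \<Psi> ((t, u), p2), p1))"

definition glue_graph ::
  "(R3 \<times> R3 \<Rightarrow> real) \<Rightarrow> (R3 \<times> R3 \<Rightarrow> (real \<times> complex) \<times> R3) \<Rightarrow>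
   ((R3 \<times> R3) \<times> R3 + (R3 \<times> R3) \<times> R3) rel" where
  "glue_graph \<mu>\<^sub>N \<Psi> =
     {(Inl x, Inr y) | x y. x \<in> U_set \<mu>\<^sub>N \<and> y \<in> U_set \<mu>\<^sub>N \<and> g_swap \<mu>\<^sub>N \<Psi> x = y}"

text \<open>Reflexivity and symmetry suffice to make this an equivalence relation, because the swap
  is a bijection of \<open>U\<close>.\<close>

definition glue_rel ::
  "(R3 \<times> R3 \<Rightarrow> real) \<Rightarrow> (R3 \<times> R3 \<Rightarrow> (real \<times> complex) \<times> R3) \<Rightarrow>
   ((R3 \<times> R3) \<times> R3 + (R3 \<times> R3) \<times> R3) rel" where
  "glue_rel \<mu>\<^sub>N \<Psi> = Id_on (M_minus \<mu>\<^sub>N <+> M_plus \<mu>\<^sub>N) \<union> glue_graph \<mu>\<^sub>N \<Psi> \<union> (glue_graph \<mu>\<^sub>N \<Psi>)\<inverse>"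

datatype side = Minus | Plus

text \<open>Points of \<open>M'\<close> are equivalence classes. The action and the momentum map are evaluated on
  representatives: a group element maps a class onto a class, and \<open>\<mu>\<close> is constant on classes.\<close>

definition M'_mfd ::
  "real \<Rightarrow> (R3 \<times> R3 \<Rightarrow> real) \<Rightarrow> (R3 \<times> R3 \<Rightarrow> (real \<times> complex) \<times> R3) \<Rightarrow>
   (side, (R3 \<times> R3) \<times> R3, ((R3 \<times> R3) \<times> R3 + (R3 \<times> R3) \<times> R3) set) S1_manifold" where
  "M'_mfd \<epsilon> \<mu>\<^sub>N \<Psi> =
     \<lparr>idx = UNIV,
      patch = case_side (M_minus \<mu>\<^sub>N) (M_plus \<mu>\<^sub>N),
      glue = case_side (\<lambda>x. glue_rel \<mu>\<^sub>N \<Psi> `` {Inl x}) (\<lambda>y. glue_rel \<mu>\<^sub>N \<Psi> `` {Inr y}),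
      form = (\<lambda>_. omega_M \<epsilon>),
      act = (\<lambda>s C. map_sum (act_M s) (act_M s) ` C),
      mom = (\<lambda>C. the_elem (case_sum (mu_M \<mu>\<^sub>N) (mu_M \<mu>\<^sub>N) ` C))\<rparr>"

end

theory Submission
  imports Defs
begin

text \<open>
  The obstruction is the homotopy class of a fixed sphere in the orbit space. In \<open>M\<close> the
  projection to the last factor is invariant under the circle and maps each of the four fixed spheres
  bijectively onto \<open>S\<^sup>2\<close>, so that no fixed sphere can be contracted in \<open>M / S\<^sup>1\<close>. In
  \<open>M'\<close>, on the other hand, the fixed sphere over (southpole, northpole) is contractible in
  \<open>M' / S\<^sup>1\<close>: since the swap exchanges the two sphere factors over \<open>U\<close>, the last factor
  of \<open>M\<^sub>-\<close> becomes the reduced sphere of \<open>N'\<close> in \<open>M\<^sub>+\<close>, and that sphere is collapsed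
  when it is pushed up to the maximum of the momentum map. (Topologically,
  \<open>M / S\<^sup>1\<close> is \<open>S\<^sup>3 \<times> S\<^sup>2\<close> and \<open>M' / S\<^sup>1\<close> is \<open>S\<^sup>5\<close>.)

  The orbit spaces are not constructed. Instead, a contraction in \<open>M' / S\<^sup>1\<close> is tested
  against invariant continuous maps \<open>f\<close> from \<open>M'\<close> to \<open>S\<^sup>2\<close>: the lemma
  \<open>fixed_sphere_nullhomotopic\<close> shows that every such \<open>f\<close> is nullhomotopic on the
  fixed sphere. Given an equivariant diffeomorphism \<open>F\<close> from \<open>M\<close> to \<open>M'\<close>, let
  \<open>f\<close> be the inverse of \<open>F\<close> followed by the projection to the last factor. It maps the fixed
  sphere injectively to \<open>S\<^sup>2\<close>, because the inverse of \<open>F\<close> maps it into a single fixed sphere of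
  \<open>M\<close>. But an injective self-map of \<open>S\<^sup>2\<close> is not nullhomotopic
  (\<open>injective_sphere_map_not_nullhomotopic\<close>). Equivariant symplectomorphisms and
  \<open>\<mu>\<close>-\<open>S\<^sup>1\<close>-diffeomorphisms are both equivariant diffeomorphisms, so this excludes both.

  The homotopy has to stay inside \<open>M\<^sub>-\<close> and then inside \<open>M\<^sub>+\<close>, which are given by
  inequalities for the momentum map. Integrating \<open>d\<mu> = - \<omega>(\<xi>, \<cdot>)\<close> along great circles shows that
  \<open>\<mu>\<^sub>N\<close> is \<open>((1 + \<epsilon>) h\<^sub>1 + h\<^sub>2) / 4\<close> up to a constant, where \<open>h\<^sub>1\<close> and
  \<open>h\<^sub>2\<close> are the heights (\<open>momentum_map_diag_act_eq\<close>).
\<close>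

section \<open>The round sphere and its rotations\<close>

lemma mem_S2: "(z, h) \<in> S2 \<longleftrightarrow> (cmod z)\<^sup>2 + h\<^sup>2 = 1"
  by (auto simp: S2_def norm_Pair)

lemma abs_height_le_1: "p \<in> S2 \<Longrightarrow> \<bar>snd p\<bar> \<le> 1"
  using norm_snd_le[of "snd p" "fst p"] by (simp add: S2_def)

definition meridian :: "real \<Rightarrow> R3" where
  "meridian h = (of_real (sqrt (1 - h\<^sup>2)), h)"

lemma snd_meridian [simp]: "snd (meridian h) = h"
  by (simp add: meridian_def)

lemma meridian_poles: "meridian (-1) = southpole" "meridian 1 = northpole"
  by (auto simp: meridian_def southpole_def northpole_def)

lemma meridian_in_S2: "\<bar>h\<bar> \<le> 1 \<Longrightarrow> meridian h \<in> S2"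
  by (simp add: meridian_def mem_S2 abs_square_le_1)

lemma continuous_on_meridian [continuous_intros]:
  "continuous_on A f \<Longrightarrow> continuous_on A (\<lambda>x. meridian (f x))"
  unfolding meridian_def by (intro continuous_intros)

lemma rot_meridian:
  assumes "p \<in> S2"
  obtains s where "s \<in> S1" "rot s (meridian (snd p)) = p"
proof -
  obtain z h where p: "p = (z, h)" by (cases p)
  have "(cmod z)\<^sup>2 = 1 - h\<^sup>2"
    using assms by (simp add: p mem_S2)
  then have m: "meridian h = (of_real (cmod z), h)"
    unfolding meridian_def by (metis norm_ge_zero real_sqrt_unique)
  show thesis
  proof (cases "z = 0")
    case True
    then have "rot 1 (meridian (snd p)) = p" by (simp add: p m rot_def)
    then show ?thesis by (intro that[of 1]) (simp_all add: S1_def)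
  next
    case False
    then have "rot (sgn z) (meridian (snd p)) = p" by (simp add: p m rot_def sgn_eq)
    moreover have "sgn z \<in> S1" using False by (simp add: S1_def norm_sgn)
    ultimately show ?thesis by (intro that[of "sgn z"])
  qed
qed

lemma poles_in_S2: "southpole \<in> S2" "northpole \<in> S2"
  by (auto simp: southpole_def northpole_def mem_S2)

lemma rot_in_S2: "s \<in> S1 \<Longrightarrow> p \<in> S2 \<Longrightarrow> rot s p \<in> S2"
  by (cases p) (auto simp: mem_S2 rot_def S1_def norm_mult)

lemma rot_poles: "rot s southpole = southpole" "rot s northpole = northpole"
  by (auto simp: rot_def southpole_def northpole_def)

lemma rot_fixed_imp_pole:
  assumes "p \<in> S2" "\<And>s. s \<in> S1 \<Longrightarrow> rot s p = p"
  shows "p \<in> {southpole, northpole}"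
proof -
  obtain z h where p: "p = (z, h)" by (cases p)
  have "rot (-1) p = p" using assms(2) by (simp add: S1_def)
  then have "z = 0" by (simp add: p rot_def)
  then have "h\<^sup>2 = 1" using assms(1) by (simp add: p mem_S2)
  then show ?thesis using \<open>z = 0\<close> by (auto simp: p southpole_def northpole_def power2_eq_1_iff)
qed

text \<open>Every point lies on a great circle through the southpole (at \<open>\<theta> = 0\<close>); these are the
  curves along which the momentum map is integrated.\<close>

lemma great_circle_through:
  assumes "p \<in> S2"
  obtains s \<theta> where "cmod s = 1" "p = (s * of_real (sin \<theta>), - cos \<theta>)"
proof -
  obtain s where s: "s \<in> S1" "rot s (meridian (snd p)) = p"
    using rot_meridian[OF assms] by blast
  define \<theta> where "\<theta> = arccos (- snd p)"
  have "cos \<theta> = - snd p" "sin \<theta> = sqrt (1 - (snd p)\<^sup>2)"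
    using abs_height_le_1[OF assms] by (simp_all add: \<theta>_def cos_arccos sin_arccos)
  then have "rot s (meridian (snd p)) = (s * of_real (sin \<theta>), - cos \<theta>)"
    by (simp add: rot_def meridian_def)
  with s(2) have "p = (s * of_real (sin \<theta>), - cos \<theta>)"
    by (rule trans[OF sym])
  moreover have "cmod s = 1" using s(1) by (simp add: S1_def)
  ultimately show thesis by (intro that)
qed

section \<open>Momentum maps\<close>

lemma smooth_on_imp_continuous_on:
  assumes "smooth_on S f"
  shows "continuous_on S f"
  unfolding continuous_on_eq_continuous_within
proof
  fix x assume x: "x \<in> S"
  then obtain U g where U: "open U" "x \<in> U" and g: "\<forall>k. Ck_on k U g" "\<forall>y\<in>S \<inter> U. g y = f y"
    using assms unfolding smooth_on_def by blast
  have "continuous_on U g" using g(1)[rule_format, of 0] by simp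
  then have "continuous (at x within S) g"
    using U continuous_on_eq_continuous_at continuous_at_imp_continuous_within by blast
  moreover have "\<forall>\<^sub>F y in at x within S. g y = f y"
    using U g(2) unfolding eventually_at_topological by blast
  ultimately show "continuous (at x within S) f"
    using x U g(2) unfolding continuous_within
    by (metis Int_iff filterlim_cong)
qed

text \<open>The derivative of a local extension to the ambient space is a derivative within \<open>S\<close>. This
  makes the defining condition of a momentum map, which speaks of all such derivatives, applicable.\<close>

lemma smooth_on_imp_has_derivative:
  assumes "smooth_on S f" "x \<in> S"
  obtains D where "(f has_derivative D) (at x within S)"
proof -
  obtain U g where U: "open U" "x \<in> U" and g: "\<forall>k. Ck_on k U g" "\<forall>y\<in>S \<inter> U. g y = f y"
    using assms unfolding smooth_on_def by blast
  have "g differentiable (at x)" using g(1)[rule_format, of "Suc 0"] U by simp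
  then obtain D where "(g has_derivative D) (at x within S)"
    unfolding differentiable_def using has_derivative_at_withinI by blast
  moreover have "\<forall>\<^sub>F y in at x within S. g y = f y"
    using U g(2) unfolding eventually_at_topological by blast
  ultimately have "(f has_derivative D) (at x within S)"
    using has_derivative_transform_eventually assms(2) U g(2) by blast
  then show thesis by (rule that)
qed

lemma momentum_map_along_curve:
  assumes \<mu>: "momentum_map P \<omega> \<alpha> \<mu>"
    and c: "\<And>t. c t \<in> P" "(c has_vector_derivative v) (at t)"
  shows "((\<lambda>t. \<mu> (c t)) has_real_derivative - \<omega> (c t) (fundamental_field \<alpha> (c t)) v) (at t)"
proof -
  obtain D where D: "(\<mu> has_derivative D) (at (c t) within P)"
    using smooth_on_imp_has_derivative \<mu> c(1) unfolding momentum_map_def by metis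
  have "((\<lambda>s. t + s) has_vector_derivative 1) (at 0)"
    by (auto simp: has_vector_derivative_def intro!: derivative_eq_intros)
  then have "((\<lambda>s. c (t + s)) has_vector_derivative v) (at 0)"
    using c(2) vector_diff_chain_at[of "\<lambda>s. t + s" 1 0 c v] by (simp add: o_def)
  then have "v \<in> tangent_space P (c t)"
    using c(1) unfolding tangent_space_def by (intro CollectI exI[of _ "\<lambda>s. c (t + s)"]) auto
  then have Dv: "D v = - \<omega> (c t) (fundamental_field \<alpha> (c t)) v"
    using D \<mu> c(1) unfolding momentum_map_def by blast
  have "(\<mu> has_derivative D) (at (c t) within range c)"
    using D c(1) by (meson has_derivative_subset image_subsetI)
  then have "((\<lambda>t. \<mu> (c t)) has_derivative (\<lambda>s. D (s *\<^sub>R v))) (at t)"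
    using has_derivative_in_compose c(2) unfolding has_vector_derivative_def by blast
  moreover have "(\<lambda>s. D (s *\<^sub>R v)) = (\<lambda>s. D v * s)"
    using has_derivative_linear[OF D] by (simp add: linear_cmul mult.commute)
  ultimately have "((\<lambda>t. \<mu> (c t)) has_derivative (\<lambda>s. D v * s)) (at t)" by simp
  then show ?thesis by (simp add: has_field_derivative_def flip: Dv)
qed

lemma fundamental_field_diag_act:
  "fundamental_field diag_act ((z1, h1), (z2, h2)) = ((\<i> * z1, 0), (\<i> * z2, 0))"
proof -
  have "((\<lambda>\<theta>. diag_act (cis \<theta>) ((z1, h1), (z2, h2)))
      has_vector_derivative ((\<i> * z1, 0), (\<i> * z2, 0))) (at 0)"
    unfolding diag_act_def rho1_def rot_def has_vector_derivative_def
    by (auto intro!: derivative_eq_intros simp: scaleR_conv_of_real)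
  then show ?thesis
    unfolding fundamental_field_def by (rule vector_derivative_at)
qed

text \<open>The points \<open>n\<close> and (southpole, southpole) are joined by a curve that is a great circle in
  each factor. Along it, \<open>- \<omega>(\<xi>, \<cdot>)\<close> of the velocity is the derivative of a quarter of the
  weighted height.\<close>

lemma momentum_map_diag_act_eq:
  assumes \<mu>: "momentum_map N_set (omega_N \<epsilon>) diag_act \<mu>" and n: "n \<in> N_set"
  shows "\<mu> n = \<mu> (southpole, southpole) + ((1 + \<epsilon>) * (snd (fst n) + 1) + (snd (snd n) + 1)) / 4"
proof -
  obtain n1 n2 where n12: "n = (n1, n2)" "n1 \<in> S2" "n2 \<in> S2"
    using n by (auto simp: N_set_def)
  obtain s1 \<theta>1 where n1: "cmod s1 = 1" "n1 = (s1 * of_real (sin \<theta>1), - cos \<theta>1)"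
    using great_circle_through[OF n12(2)] by blast
  obtain s2 \<theta>2 where n2: "cmod s2 = 1" "n2 = (s2 * of_real (sin \<theta>2), - cos \<theta>2)"
    using great_circle_through[OF n12(3)] by blast
  define c where "c t = ((s1 * of_real (sin (t * \<theta>1)), - cos (t * \<theta>1)),
      (s2 * of_real (sin (t * \<theta>2)), - cos (t * \<theta>2)))" for t
  define v where "v t = ((s1 * of_real (\<theta>1 * cos (t * \<theta>1)), \<theta>1 * sin (t * \<theta>1)),
      (s2 * of_real (\<theta>2 * cos (t * \<theta>2)), \<theta>2 * sin (t * \<theta>2)))" for t
  have c: "c t \<in> N_set" for t
    by (simp add: c_def N_set_def mem_S2 norm_mult n1 n2)
  have v: "(c has_vector_derivative v t) (at t)" for t
    unfolding c_def v_def has_vector_derivative_def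
    by (auto intro!: derivative_eq_intros simp: scaleR_conv_of_real algebra_simps)
  have u: "cnj s * s = 1" if "cmod s = 1" for s
    using that by (simp add: mult.commute flip: complex_norm_square)
  have fs: "fubini_study (s * of_real (sin x), - cos x) (\<i> * (s * of_real (sin x)), 0)
      (s * of_real (\<theta> * cos x), \<theta> * sin x) = - (\<theta> * sin x) / 4" if "cmod s = 1" for s x \<theta>
  proof -
    have *: "cnj (s * of_real a) * (s * of_real b) = of_real (a * b)"
      "cnj (s * of_real a) * (\<i> * (s * of_real b)) = \<i> * of_real (a * b)"
      "cnj (\<i> * (s * of_real a)) * (s * of_real b) = - \<i> * of_real (a * b)" for a b
      using u[OF that] by (simp_all add: algebra_simps)
    have "fubini_study (s * of_real (sin x), - cos x) (\<i> * (s * of_real (sin x)), 0)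
      (s * of_real (\<theta> * cos x), \<theta> * sin x)
      = (- (\<theta> * sin x) * (sin x * sin x) + cos x * (- (sin x * (\<theta> * cos x)))) / 4"
      unfolding fubini_study_def by (simp only: prod.case * ) (simp)
    also have "\<dots> = - (\<theta> * sin x) * ((sin x)\<^sup>2 + (cos x)\<^sup>2) / 4"
      by (simp add: algebra_simps power2_eq_square
          del: sin_cos_squared_add sin_cos_squared_add2 sin_cos_squared_add3)
    finally show ?thesis by simp
  qed
  \<comment> \<open>The difference of the momentum map and its expected value is constant along the curve.\<close>
  define E where "E t = \<mu> (c t) - ((1 + \<epsilon>) * (- cos (t * \<theta>1)) + (- cos (t * \<theta>2))) / 4" for t
  have "(E has_real_derivative 0) (at t)" for t
  proof -
    have w: "- omega_N \<epsilon> (c t) (fundamental_field diag_act (c t)) (v t)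
        = ((1 + \<epsilon>) * (\<theta>1 * sin (t * \<theta>1)) + \<theta>2 * sin (t * \<theta>2)) / 4"
      unfolding c_def v_def fundamental_field_diag_act omega_N_def
      using fs[OF n1(1)] fs[OF n2(1)] by (simp add: field_simps)
    have "((\<lambda>t. \<mu> (c t)) has_real_derivative
        ((1 + \<epsilon>) * (\<theta>1 * sin (t * \<theta>1)) + \<theta>2 * sin (t * \<theta>2)) / 4) (at t)"
      using momentum_map_along_curve[OF \<mu> c v, of t] unfolding w .
    then show ?thesis
      unfolding E_def by (auto intro!: derivative_eq_intros simp: field_simps)
  qed
  then have "E 1 = E 0"
    using DERIV_isconst_all by blast
  moreover have "c 1 = n" "c 0 = (southpole, southpole)"
    by (simp_all add: c_def n12 n1 n2 southpole_def)
  ultimately show ?thesis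
    by (simp add: E_def n12 n1 n2 field_simps)
qed

section \<open>Injective self-maps of the sphere\<close>

text \<open>If \<open>f\<close> missed a point, it would embed the sphere in the plane, which is impossible for
  dimension reasons. So \<open>f\<close> is a homeomorphism, and composing a nullhomotopy of \<open>f\<close> with its inverse
  would contract the sphere.\<close>

lemma injective_sphere_map_not_nullhomotopic:
  assumes hom: "homotopic_with_canon (\<lambda>_. True) S2 S2 f (\<lambda>_. a)" and inj: "inj_on f S2"
  shows False
proof -
  have f: "continuous_on S2 f" "f \<in> S2 \<rightarrow> S2"
    using homotopic_with_imp_continuous[OF hom] homotopic_with_imp_funspace1[OF hom] by auto
  have "f ` S2 = S2"
  proof (rule ccontr)
    assume "f ` S2 \<noteq> S2"
    then obtain b where b: "b \<in> S2" "b \<notin> f ` S2" using f by blast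
    have "S2 - {b} homeomorphic (UNIV :: complex set)"
      using b unfolding S2_def
      by (intro homeomorphic_punctured_sphere_affine) auto
    then obtain g k where g: "homeomorphism (S2 - {b}) (UNIV :: complex set) g k"
      unfolding homeomorphic_def by blast
    have img: "f ` S2 \<subseteq> S2 - {b}" using f(2) b(2) by auto
    have "continuous_on S2 (g \<circ> f)"
      by (rule continuous_on_compose[OF f(1) continuous_on_subset[OF homeomorphism_cont1[OF g] img]])
    moreover have "inj_on (g \<circ> f) S2"
    proof (rule comp_inj_on[OF inj])
      have "inj_on g (S2 - {b})" by (rule inj_on_inverseI) (rule homeomorphism_apply1[OF g])
      then show "inj_on g (f ` S2)" using img by (rule inj_on_subset)
    qed
    ultimately have "DIM(R3) \<le> DIM(complex)"
      unfolding S2_def by (rule no_embedding_sphere_lowdim) simp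
    then show False by simp
  qed
  then obtain g where g: "homeomorphism S2 S2 f g"
    using homeomorphism_compact[of S2 f S2] f inj by (auto simp: S2_def)
  have "homotopic_with_canon (\<lambda>_. True) S2 S2 (g \<circ> f) (g \<circ> (\<lambda>_. a))"
    using g by (intro homotopic_with_compose_continuous_left[OF hom])
      (auto simp: homeomorphism_def)
  then have "homotopic_with_canon (\<lambda>_. True) S2 S2 id (\<lambda>_. g a)"
    by (rule homotopic_with_eq) (auto simp: homeomorphism_apply1[OF g])
  then have "contractible S2" unfolding contractible_def by blast
  then show False by (simp add: S2_def contractible_sphere)
qed

section \<open>The glued manifold\<close>

lemma points_embedded: "points (embedded P \<omega>) = P"
  by (simp add: points_def embedded_def)

lemma M_mfd_simps:
  "idx (M_mfd \<epsilon> \<mu>) = UNIV" "patch (M_mfd \<epsilon> \<mu>) i = M_set" "glue (M_mfd \<epsilon> \<mu>) i = (\<lambda>x. x)"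
  "act (M_mfd \<epsilon> \<mu>) = act_M" "points (M_mfd \<epsilon> \<mu>) = M_set"
  by (simp_all add: M_mfd_def embedded_def form_manifold.defs S1_manifold.defs points_def)

lemma M'_mfd_simps:
  "idx (M'_mfd \<epsilon> \<mu> \<Psi>) = UNIV"
  "patch (M'_mfd \<epsilon> \<mu> \<Psi>) Minus = M_minus \<mu>"
  "patch (M'_mfd \<epsilon> \<mu> \<Psi>) Plus = M_plus \<mu>"
  "glue (M'_mfd \<epsilon> \<mu> \<Psi>) Minus x = glue_rel \<mu> \<Psi> `` {Inl x}"
  "glue (M'_mfd \<epsilon> \<mu> \<Psi>) Plus y = glue_rel \<mu> \<Psi> `` {Inr y}"
  "act (M'_mfd \<epsilon> \<mu> \<Psi>) s C = map_sum (act_M s) (act_M s) ` C"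
  by (simp_all add: M'_mfd_def)

lemma glue_in_points: "i \<in> idx X \<Longrightarrow> p \<in> patch X i \<Longrightarrow> glue X i p \<in> points X"
  unfolding points_def by blast

text \<open>If the target is covered by one patch that is its own set of points, then the domain of a
  local representative is the whole patch and the local representative is the map itself.\<close>

lemma smooth_map_imp_continuous_on:
  assumes F: "smooth_map X Y F" and ij: "i \<in> idx X" "j \<in> idx Y"
    and Y: "glue Y j = (\<lambda>y. y)" "points Y = patch Y j"
  shows "continuous_on (patch X i) (\<lambda>p. F (glue X i p))"
proof -
  have img: "F (glue X i p) \<in> patch Y j" if "p \<in> patch X i" for p
    using F that glue_in_points[OF ij(1)] Y unfolding smooth_map_def by blast
  then have "rep_dom X Y F i j = patch X i"
    by (auto simp: rep_dom_def Y)
  then have "continuous_on (patch X i) (local_rep X Y F i j)"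
    using F ij smooth_on_imp_continuous_on unfolding smooth_map_def by metis
  moreover have "local_rep X Y F i j p = F (glue X i p)" if "p \<in> patch X i" for p
    using img[OF that] inv_into_f_f[of "\<lambda>y. y" "patch Y j"] by (simp add: local_rep_def Y)
  ultimately show ?thesis by (simp cong: continuous_on_cong)
qed

lemma U_set_eq: "U_set \<mu> = N'_set \<mu> \<times> S2"
  by (auto simp: U_set_def N'_set_def M_set_def mu_M_def)

lemma U_set_subset: "U_set \<mu> \<subseteq> M_minus \<mu> \<inter> M_plus \<mu>"
  by (auto simp: U_set_def M_minus_def M_plus_def)

lemma g_swap_involution:
  assumes \<Psi>: "bij_betw \<Psi> (N'_set \<mu>) (model_set \<mu>)" and x: "x \<in> U_set \<mu>"
  shows "g_swap \<mu> \<Psi> x \<in> U_set \<mu>" "g_swap \<mu> \<Psi> (g_swap \<mu> \<Psi> x) = x"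
proof -
  obtain n p where np: "x = (n, p)" "n \<in> N'_set \<mu>" "p \<in> S2"
    using x by (auto simp: U_set_eq)
  obtain t u q where tuq: "\<Psi> n = ((t, u), q)"
    by (metis prod.exhaust)
  have "((t, u), q) \<in> model_set \<mu>"
    using \<Psi> np(2) tuq by (metis bij_betwE)
  then have q: "q \<in> S2" and m: "((t, u), p) \<in> model_set \<mu>"
    using np(3) by (auto simp: model_set_def)
  define n' where "n' = inv_into (N'_set \<mu>) \<Psi> ((t, u), p)"
  have n': "n' \<in> N'_set \<mu>" "\<Psi> n' = ((t, u), p)"
    using \<Psi> m unfolding n'_def
    by (metis bij_betw_def inv_into_into, metis bij_betw_inv_into_right)
  have "g_swap \<mu> \<Psi> x = (n', q)"
    by (simp add: g_swap_def np tuq n'_def)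
  moreover have "g_swap \<mu> \<Psi> (n', q) = (n, p)"
    using bij_betw_inv_into_left[OF \<Psi> np(2)] by (simp add: g_swap_def n' tuq)
  ultimately show "g_swap \<mu> \<Psi> x \<in> U_set \<mu>" "g_swap \<mu> \<Psi> (g_swap \<mu> \<Psi> x) = x"
    using n' q by (auto simp: U_set_eq np)
qed

lemma glue_class_outside_U:
  "x \<in> M_minus \<mu> - U_set \<mu> \<Longrightarrow> glue_rel \<mu> \<Psi> `` {Inl x} = {Inl x}"
  "y \<in> M_plus \<mu> - U_set \<mu> \<Longrightarrow> glue_rel \<mu> \<Psi> `` {Inr y} = {Inr y}"
  by (auto simp: glue_rel_def glue_graph_def)

text \<open>Since the swap is injective, a class over \<open>U\<close> has exactly one representative on
  each side.\<close>

lemma glue_class_swap: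
  assumes \<Psi>: "bij_betw \<Psi> (N'_set \<mu>) (model_set \<mu>)" and x: "x \<in> U_set \<mu>"
  shows "glue_rel \<mu> \<Psi> `` {Inl x} = glue_rel \<mu> \<Psi> `` {Inr (g_swap \<mu> \<Psi> x)}"
proof -
  have "glue_rel \<mu> \<Psi> `` {Inl x} = {Inl x, Inr (g_swap \<mu> \<Psi> x)}"
    using x U_set_subset g_swap_involution(1)[OF \<Psi> x]
    by (auto simp: glue_rel_def glue_graph_def simp del: split_paired_Ex)
  moreover have "glue_rel \<mu> \<Psi> `` {Inr (g_swap \<mu> \<Psi> x)} = {Inl x, Inr (g_swap \<mu> \<Psi> x)}"
  proof -
    have "x' = x" if "x' \<in> U_set \<mu>" "g_swap \<mu> \<Psi> x' = g_swap \<mu> \<Psi> x" for x'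
      using g_swap_involution(2)[OF \<Psi>] that x by metis
    then show ?thesis
      using x U_set_subset[of \<mu>] g_swap_involution(1)[OF \<Psi> x]
      by (auto simp: glue_rel_def glue_graph_def simp del: split_paired_Ex)
  qed
  ultimately show ?thesis by simp
qed

section \<open>Contracting a fixed sphere in the orbit space\<close>

text \<open>\<open>raise \<tau>\<close> moves a point up its meridian, with height affine in \<open>\<tau>\<close>, to the northpole.
  The scaling factor is the ratio of the radii, the square root of
  \<open>(1 - h'\<^sup>2) / (1 - h\<^sup>2)\<close>, with the common factor \<open>1 - h\<close> cancelled; it is therefore
  continuous at the northpole, and the southpole is the only exception.\<close>

definition raise :: "real \<Rightarrow> R3 \<Rightarrow> R3" where
  "raise \<tau> = (\<lambda>(z, h). let h' = (1 - \<tau>) * h + \<tau> in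
     (z * of_real (sqrt ((1 - \<tau>) * (1 + h') / (1 + h))), h'))"

lemma snd_raise: "snd (raise \<tau> p) = (1 - \<tau>) * snd p + \<tau>"
  by (cases p) (simp add: raise_def Let_def)

lemma raise_0: "snd p > -1 \<Longrightarrow> raise 0 p = p"
  by (cases p) (simp add: raise_def Let_def)

lemma raise_1: "raise 1 p = northpole"
  by (cases p) (simp add: raise_def Let_def northpole_def)

lemma raise_in_S2:
  assumes p: "p \<in> S2" "snd p > -1" and \<tau>: "0 \<le> \<tau>" "\<tau> \<le> 1"
  shows "raise \<tau> p \<in> S2"
proof -
  obtain z h where zh: "p = (z, h)" by (cases p)
  define h' where "h' = (1 - \<tau>) * h + \<tau>"
  have h: "h > -1" using p(2) by (simp add: zh)
  have z: "(cmod z)\<^sup>2 = (1 - h) * (1 + h)"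
    using p(1) by (simp add: zh mem_S2 algebra_simps power2_eq_square)
  have h1: "1 - h' = (1 - \<tau>) * (1 - h)" by (simp add: h'_def algebra_simps)
  have "1 + h' = (1 - \<tau>) * (1 + h) + 2 * \<tau>" by (simp add: h'_def algebra_simps)
  then have "0 \<le> 1 + h'" using h \<tau> by simp
  then have r: "0 \<le> (1 - \<tau>) * (1 + h') / (1 + h)" using h \<tau> by simp
  have "(cmod z)\<^sup>2 * ((1 - \<tau>) * (1 + h') / (1 + h)) = (1 - h') * (1 + h')"
    using h by (simp add: z h1)
  moreover have "(cmod (z * of_real (sqrt ((1 - \<tau>) * (1 + h') / (1 + h)))))\<^sup>2
      = (cmod z)\<^sup>2 * ((1 - \<tau>) * (1 + h') / (1 + h))"
    using r by (simp only: norm_mult power_mult_distrib norm_of_real power2_abs real_sqrt_pow2)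
  ultimately have "(z * of_real (sqrt ((1 - \<tau>) * (1 + h') / (1 + h))), h') \<in> S2"
    by (simp only: mem_S2) (simp add: algebra_simps power2_eq_square)
  then show ?thesis by (simp add: zh raise_def Let_def h'_def)
qed

lemma continuous_on_raise:
  assumes "continuous_on A f" "continuous_on A g" "\<And>x. x \<in> A \<Longrightarrow> snd (g x) > -1"
  shows "continuous_on A (\<lambda>x. raise (f x) (g x))"
proof -
  have "1 + snd (g x) \<noteq> 0" if "x \<in> A" for x
    using assms(3)[OF that] by simp
  then show ?thesis
    unfolding raise_def case_prod_unfold Let_def
    by (intro continuous_intros assms ballI)
qed

lemma homotopic_on_interval:
  assumes "continuous_on ({0..1} \<times> S) (\<lambda>x. H (fst x) (snd x))"
    and "\<And>\<tau> p. 0 \<le> \<tau> \<Longrightarrow> \<tau> \<le> 1 \<Longrightarrow> p \<in> S \<Longrightarrow> H \<tau> p \<in> T"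
  shows "homotopic_with_canon (\<lambda>_. True) S T (H (0::real)) (H 1)"
  unfolding homotopic_with_def
  by (intro exI[of _ "\<lambda>x. H (fst x) (snd x)"])
    (use assms in \<open>auto simp: prod_topology_subtopology_eu\<close>)

text \<open>The homotopy has three stages. In \<open>M\<^sub>-\<close>, the first two coordinates are moved along a
  path in \<open>N\<close> from (southpole, northpole) to a point \<open>n\<^sub>0\<close> of \<open>N'\<close>, the last coordinate
  \<open>p\<close> being kept. Over \<open>U\<close> the swap identifies \<open>(n\<^sub>0, p)\<close> with a point
  \<open>(n(p), q\<^sub>0)\<close> of \<open>M\<^sub>+\<close> in which \<open>q\<^sub>0\<close> does not depend on \<open>p\<close>. There, the first
  component of \<open>n(p)\<close> is raised to the northpole. The values of \<open>f\<close> on the resulting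
  sphere are constant on circles of latitude of the second component of \<open>n(p)\<close>, since the circle acts
  on these points by rotating that component alone. Hence \<open>f\<close> factors through the
  height of that component, that is, through the contractible interval \<open>[-1, 1]\<close>.\<close>

lemma fixed_sphere_nullhomotopic:
  assumes \<epsilon>: "\<epsilon> > 0" and mom: "momentum_map N_set (omega_N \<epsilon>) diag_act \<mu>"
    and tor: "toric_identification \<epsilon> \<mu> \<Psi>"
  defines "X' \<equiv> M'_mfd \<epsilon> \<mu> \<Psi>"
  assumes f: "f \<in> points X' \<rightarrow> S2"
    and cont: "\<And>i. continuous_on (patch X' i) (\<lambda>x. f (glue X' i x))"
    and inv: "\<And>s C. s \<in> S1 \<Longrightarrow> C \<in> points X' \<Longrightarrow> f (act X' s C) = f C"
  shows "\<exists>a. homotopic_with_canon (\<lambda>_. True) S2 S2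
    (\<lambda>p. f (glue X' Minus ((southpole, northpole), p))) (\<lambda>_. a)"
proof -
  define \<mu>0 where "\<mu>0 = \<mu> (southpole, southpole)"
  have \<mu>: "\<mu> (p, q) = \<mu>0 + ((1 + \<epsilon>) * (snd p + 1) + (snd q + 1)) / 4"
    if "p \<in> S2" "q \<in> S2" for p q
    using momentum_map_diag_act_eq[OF mom, of "(p, q)"] that by (simp add: N_set_def \<mu>0_def)
  have crit: "crit1 \<mu> = \<mu>0 + 2 / 4" "crit2 \<mu> = \<mu>0 + (2 + 2 * \<epsilon>) / 4"
    unfolding crit1_def crit2_def using poles_in_S2
    by (simp_all add: \<mu> southpole_def northpole_def)
  have \<Psi>: "bij_betw \<Psi> (N'_set \<mu>) (model_set \<mu>)"
    and sm: "smooth_map (embedded (model_set \<mu>) model_form) (embedded (N'_set \<mu>) (omega_N \<epsilon>))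
      (inv_into (N'_set \<mu>) \<Psi>)"
    using tor unfolding toric_identification_def symplectomorphism_def diffeomorphism_def
    by (simp_all add: points_embedded)
  have \<Psi>inv: "continuous_on (model_set \<mu>) (inv_into (N'_set \<mu>) \<Psi>)"
    using smooth_map_imp_continuous_on[OF sm] by (simp add: embedded_def points_def)
  have fM: "f (glue X' Minus x) \<in> S2" if "x \<in> M_minus \<mu>" for x
    using f glue_in_points[of Minus X' x] that by (auto simp: X'_def M'_mfd_simps)
  have fP: "f (glue X' Plus x) \<in> S2" if "x \<in> M_plus \<mu>" for x
    using f glue_in_points[of Plus X' x] that by (auto simp: X'_def M'_mfd_simps)
  have contM: "continuous_on (M_minus \<mu>) (\<lambda>x. f (glue X' Minus x))"
    and contP: "continuous_on (M_plus \<mu>) (\<lambda>x. f (glue X' Plus x))"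
    using cont[of Minus] cont[of Plus] by (simp_all add: X'_def M'_mfd_simps)

  \<comment> \<open>The path \<open>\<tau> \<mapsto> (meridian (\<tau> - 1), meridian (1 - \<tau>))\<close> has momentum
    \<open>crit1 \<mu> + \<epsilon> * \<tau> / 4\<close>, which is halfway between the critical values at \<open>\<tau> = 1\<close>.\<close>
  define n0 where "n0 = (meridian 0, meridian 0)"
  have n0: "n0 \<in> N'_set \<mu>"
    using \<epsilon> by (simp add: n0_def N'_set_def N_set_def meridian_in_S2 \<mu> crit field_simps)
  define H1 where "H1 \<tau> p = f (glue X' Minus ((meridian (\<tau> - 1), meridian (1 - \<tau>)), p))" for \<tau> p
  have m1: "((meridian (\<tau> - 1), meridian (1 - \<tau>)), p) \<in> M_minus \<mu>"
    if "0 \<le> \<tau>" "\<tau> \<le> 1" "p \<in> S2" for \<tau> p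
  proof -
    have "\<epsilon> * \<tau> \<le> \<epsilon> * 1" using that \<epsilon> by (intro mult_left_mono) auto
    then show ?thesis
      using that \<epsilon>
      by (simp add: M_minus_def M_set_def N_set_def mu_M_def meridian_in_S2 \<mu> crit field_simps)
  qed
  have "homotopic_with_canon (\<lambda>_. True) S2 S2 (H1 0) (H1 1)"
  proof (rule homotopic_on_interval)
    show "continuous_on ({0..1} \<times> S2) (\<lambda>x. H1 (fst x) (snd x))"
      unfolding H1_def using m1
      by (intro continuous_on_compose2[OF contM] continuous_intros) auto
  qed (use m1 fM in \<open>auto simp: H1_def\<close>)
  moreover have "H1 0 = (\<lambda>p. f (glue X' Minus ((southpole, northpole), p)))"
    by (simp add: H1_def meridian_poles fun_eq_iff)
  moreover have "H1 1 = (\<lambda>p. f (glue X' Minus (n0, p)))"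
    by (simp add: H1_def n0_def fun_eq_iff)
  ultimately have hom1: "homotopic_with_canon (\<lambda>_. True) S2 S2
      (\<lambda>p. f (glue X' Minus ((southpole, northpole), p))) (\<lambda>p. f (glue X' Minus (n0, p)))"
    by simp

  \<comment> \<open>Passage from \<open>M_minus \<mu>\<close> to \<open>M_plus \<mu>\<close>.\<close>
  obtain t u q0 where q0: "\<Psi> n0 = ((t, u), q0)" by (metis prod.exhaust)
  have "((t, u), q0) \<in> model_set \<mu>"
    using \<Psi> n0 q0 by (metis bij_betwE)
  then have q0S: "q0 \<in> S2" and tu: "\<And>p. p \<in> S2 \<Longrightarrow> ((t, u), p) \<in> model_set \<mu>"
    by (auto simp: model_set_def)
  define n where "n p = inv_into (N'_set \<mu>) \<Psi> ((t, u), p)" for p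
  have n: "n p \<in> N'_set \<mu>" if "p \<in> S2" for p
    unfolding n_def using \<Psi> tu[OF that] by (metis bij_betw_def inv_into_into)
  have nS: "fst (n p) \<in> S2" "snd (n p) \<in> S2" if "p \<in> S2" for p
    using n[OF that] by (auto simp: N'_set_def N_set_def)
  have n_cont: "continuous_on S2 n"
    unfolding n_def using tu by (intro continuous_on_compose2[OF \<Psi>inv] continuous_intros) auto
  have swap: "f (glue X' Minus (n0, p)) = f (glue X' Plus (n p, q0))" if "p \<in> S2" for p
    using glue_class_swap[OF \<Psi>, of "(n0, p)"] n0 that
    by (simp add: X'_def M'_mfd_simps U_set_eq g_swap_def q0 n_def)

  \<comment> \<open>Momentum above \<open>crit1 \<mu>\<close> keeps the first component off the southpole, so it can be raised;
    raising it increases the momentum further.\<close>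
  have n_above: "(1 + \<epsilon>) * (snd (fst (n p)) + 1) + (snd (snd (n p)) + 1) > 2" if "p \<in> S2" for p
    using n[OF that] \<mu>[OF nS[OF that]] by (auto simp: N'_set_def crit)
  have n_not_south: "snd (fst (n p)) > -1" if "p \<in> S2" for p
  proof (rule ccontr)
    assume "\<not> snd (fst (n p)) > -1"
    then have "snd (fst (n p)) = -1" using abs_height_le_1[OF nS(1)[OF that]] by simp
    then show False using n_above[OF that] abs_height_le_1[OF nS(2)[OF that]] by simp
  qed
  define H2 where "H2 \<tau> p = f (glue X' Plus ((raise \<tau> (fst (n p)), snd (n p)), q0))" for \<tau> p
  have m2: "((raise \<tau> (fst (n p)), snd (n p)), q0) \<in> M_plus \<mu>"
    if "0 \<le> \<tau>" "\<tau> \<le> 1" "p \<in> S2" for \<tau> p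
  proof -
    have S: "raise \<tau> (fst (n p)) \<in> S2"
      using raise_in_S2[OF nS(1) n_not_south] that by simp
    have "snd (raise \<tau> (fst (n p))) = snd (fst (n p)) + \<tau> * (1 - snd (fst (n p)))"
      by (simp add: snd_raise algebra_simps)
    moreover have "0 \<le> \<tau> * (1 - snd (fst (n p)))"
      using that abs_height_le_1[OF nS(1)[OF that(3)]] by simp
    ultimately have "snd (fst (n p)) \<le> snd (raise \<tau> (fst (n p)))" by linarith
    then have "(1 + \<epsilon>) * (snd (fst (n p)) + 1) \<le> (1 + \<epsilon>) * (snd (raise \<tau> (fst (n p))) + 1)"
      using \<epsilon> by (intro mult_left_mono) auto
    then show ?thesis
      using n_above[OF that(3)] S nS(2)[OF that(3)] q0S
      by (simp add: M_plus_def M_set_def N_set_def mu_M_def \<mu> crit)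
  qed
  have "homotopic_with_canon (\<lambda>_. True) S2 S2 (H2 0) (H2 1)"
  proof (rule homotopic_on_interval)
    have "continuous_on ({0..1} \<times> S2) (\<lambda>x. n (snd x))"
      by (intro continuous_on_compose2[OF n_cont] continuous_intros) auto
    then show "continuous_on ({0..1} \<times> S2) (\<lambda>x. H2 (fst x) (snd x))"
      unfolding H2_def using m2 n_not_south
      by (intro continuous_on_compose2[OF contP] continuous_on_Pair continuous_on_raise
          continuous_intros) auto
  qed (use m2 fP in \<open>auto simp: H2_def\<close>)
  moreover have "H2 0 p = f (glue X' Minus (n0, p))" if "p \<in> S2" for p
    using that by (simp add: H2_def raise_0 n_not_south swap)
  ultimately have hom2: "homotopic_with_canon (\<lambda>_. True) S2 S2
      (\<lambda>p. f (glue X' Minus (n0, p))) (H2 1)"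
    by (auto elim: homotopic_with_eq)

  \<comment> \<open>Points with first component northpole have momentum at least \<open>crit2 \<mu>\<close>. They lie
    outside \<open>U\<close>, their classes are singletons, and the circle only rotates the second component.\<close>
  define k where "k h = f (glue X' Plus ((northpole, meridian h), q0))" for h
  have m3: "((northpole, q), q0) \<in> M_plus \<mu>" "((northpole, q), q0) \<notin> U_set \<mu>" if "q \<in> S2" for q
    using that \<epsilon> abs_height_le_1[OF that] q0S poles_in_S2
    by (auto simp: M_plus_def U_set_def M_set_def N_set_def mu_M_def \<mu> crit northpole_def)
  have "f (glue X' Plus ((northpole, q), q0)) = k (snd q)" if q: "q \<in> S2" for q
  proof -
    define x where "x = ((northpole, meridian (snd q)), q0)"
    have mer: "meridian (snd q) \<in> S2" using meridian_in_S2 abs_height_le_1[OF q] .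
    obtain s where s: "s \<in> S1" "rot s (meridian (snd q)) = q"
      using rot_meridian[OF q] by blast
    have sx: "act_M s x = ((northpole, q), q0)"
      by (simp add: x_def act_M_def diag_act_def rho1_def rot_poles s)
    have "act X' s (glue X' Plus x) = {Inr (act_M s x)}"
      using m3[OF mer] by (simp add: X'_def M'_mfd_simps glue_class_outside_U x_def)
    also have "\<dots> = glue X' Plus (act_M s x)"
      using m3[OF q] by (simp add: X'_def M'_mfd_simps glue_class_outside_U sx)
    finally have "f (glue X' Plus (act_M s x)) = f (glue X' Plus x)"
      using inv[OF s(1), of "glue X' Plus x"] glue_in_points[of Plus X' x] m3[OF mer]
      by (simp add: X'_def M'_mfd_simps x_def)
    then show ?thesis unfolding sx by (simp add: k_def x_def)
  qed
  then have H2_1: "H2 1 p = (k \<circ> (\<lambda>p. snd (snd (n p)))) p" if "p \<in> S2" for p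
    using nS(2)[OF that] by (simp add: H2_def raise_1)
  obtain a where "homotopic_with_canon (\<lambda>_. True) S2 S2 (k \<circ> (\<lambda>p. snd (snd (n p)))) (\<lambda>_. a)"
  proof (rule nullhomotopic_through_contractible)
    show "continuous_on S2 (\<lambda>p. snd (snd (n p)))"
      by (intro continuous_intros n_cont)
    show "(\<lambda>p. snd (snd (n p))) \<in> S2 \<rightarrow> {-1..1}"
      using abs_height_le_1[OF nS(2)] by (auto simp: abs_le_iff)
    have m4: "((northpole, meridian h), q0) \<in> M_plus \<mu>" if "h \<in> {-1..1}" for h
      using that by (intro m3(1) meridian_in_S2) auto
    show "continuous_on {-1..1} k"
      unfolding k_def
      by (intro continuous_on_compose2[OF contP] continuous_intros image_subsetI m4)
    show "k \<in> {-1..1} \<rightarrow> S2"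
      unfolding k_def using m4 fP by blast
    show "contractible {-1..1::real}"
      by (simp add: convex_imp_contractible)
  qed
  then have "homotopic_with_canon (\<lambda>_. True) S2 S2 (H2 1) (\<lambda>_. a)"
    by (rule homotopic_with_eq) (auto simp: H2_1)
  then show ?thesis
    using hom1 hom2 homotopic_with_trans by blast
qed

text \<open>The map \<open>p \<mapsto> G (e p)\<close> parametrises the image in \<open>M\<close> of a fixed sphere of \<open>M'\<close>.
  It consists of fixed points, so the component in \<open>N\<close> takes finitely many values; it is
  constant because \<open>S\<^sup>2\<close> is connected. The last coordinate is then an injective map on \<open>S\<^sup>2\<close>,
  but it is the restriction of an invariant map from \<open>M'\<close> to \<open>S\<^sup>2\<close> and hence nullhomotopic.\<close>

lemma no_equivariant_diffeomorphism:
  assumes \<epsilon>: "\<epsilon> > 0" and mom: "momentum_map N_set (omega_N \<epsilon>) diag_act \<mu>"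
    and tor: "toric_identification \<epsilon> \<mu> \<Psi>"
    and F: "diffeomorphism (M_mfd \<epsilon> \<mu>) (M'_mfd \<epsilon> \<mu> \<Psi>) F"
    and eq: "S1_equivariant (M_mfd \<epsilon> \<mu>) (M'_mfd \<epsilon> \<mu> \<Psi>) F"
  shows False
proof -
  define X' where "X' = M'_mfd \<epsilon> \<mu> \<Psi>"
  define G where "G = inv_into M_set F"
  have bij: "bij_betw F M_set (points X')"
    and G: "smooth_map X' (M_mfd \<epsilon> \<mu>) G"
    using F by (simp_all add: diffeomorphism_def M_mfd_simps X'_def G_def)
  have GM: "G C \<in> M_set" "F (G C) = C" if "C \<in> points X'" for C
    using bij that unfolding G_def
    by (metis bij_betw_def inv_into_into, metis bij_betw_inv_into_right)
  have act_M: "act_M s x \<in> M_set" if "s \<in> S1" "x \<in> M_set" for s x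
    using that by (auto simp: act_M_def M_set_def N_set_def diag_act_def rho1_def rot_in_S2)
  have G_act: "G (act X' s C) = act_M s (G C)" if "s \<in> S1" "C \<in> points X'" for s C
  proof -
    have "act X' s C = F (act_M s (G C))"
      using eq that GM[OF that(2)] by (simp add: S1_equivariant_def M_mfd_simps X'_def)
    then show ?thesis
      using bij_betw_inv_into_left[OF bij act_M[OF that(1) GM(1)[OF that(2)]]] by (simp add: G_def)
  qed
  have G_cont: "continuous_on (patch X' i) (\<lambda>x. G (glue X' i x))" for i
    using smooth_map_imp_continuous_on[OF G, of i "()"] by (simp add: X'_def M'_mfd_simps M_mfd_simps)

  define e where "e p = glue X' Minus ((southpole, northpole), p)" for p
  have fixed_M: "((southpole, northpole), p) \<in> M_minus \<mu> - U_set \<mu>" if "p \<in> S2" for p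
  proof -
    have "crit1 \<mu> < crit2 \<mu>"
      using momentum_map_diag_act_eq[OF mom, of "(southpole, northpole)"]
        momentum_map_diag_act_eq[OF mom, of "(northpole, southpole)"] poles_in_S2 \<epsilon>
      by (simp add: crit1_def crit2_def N_set_def) (simp add: southpole_def northpole_def)
    then show ?thesis
      using that poles_in_S2
      by (auto simp: M_minus_def U_set_def M_set_def N_set_def mu_M_def crit1_def)
  qed
  have e_class: "e p = {Inl ((southpole, northpole), p)}" if "p \<in> S2" for p
    using fixed_M[OF that] by (simp add: e_def X'_def M'_mfd_simps glue_class_outside_U)
  have e: "e p \<in> points X'" if "p \<in> S2" for p
    using glue_in_points[of Minus X'] fixed_M[OF that] by (simp add: e_def X'_def M'_mfd_simps)
  have e_fixed: "act X' s (e p) = e p" if "p \<in> S2" for s p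
    using e_class[OF that]
    by (simp add: X'_def M'_mfd_simps act_M_def diag_act_def rho1_def rot_poles)

  have "continuous_on (M_minus \<mu>) (\<lambda>x. G (glue X' Minus x))"
    using G_cont[of Minus] by (simp add: X'_def M'_mfd_simps)
  then have Ge_cont: "continuous_on S2 (\<lambda>p. G (e p))"
    unfolding e_def using fixed_M by (auto elim!: continuous_on_compose2 intro!: continuous_intros)
  define Poles where "Poles = {southpole, northpole}"
  have "fst (G (e p)) \<in> Poles \<times> Poles" if p: "p \<in> S2" for p
  proof -
    obtain n1 n2 q where n: "G (e p) = ((n1, n2), q)" by (metis prod.exhaust)
    have "n1 \<in> S2" "n2 \<in> S2"
      using GM(1)[OF e[OF p]] by (auto simp: n M_set_def N_set_def)
    moreover have "rot s n1 = n1" "rot s n2 = n2" if "s \<in> S1" for s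
      using G_act[OF that e[OF p]] e_fixed[OF p]
      by (simp_all add: n act_M_def diag_act_def rho1_def)
    ultimately have "n1 \<in> Poles" "n2 \<in> Poles"
      using rot_fixed_imp_pole unfolding Poles_def by blast+
    then show ?thesis by (simp add: n)
  qed
  then have "finite ((\<lambda>p. fst (G (e p))) ` S2)"
    by (rule finite_subset[OF image_subsetI]) (simp_all add: Poles_def)
  moreover have "connected ((\<lambda>p. fst (G (e p))) ` S2)"
    by (intro connected_continuous_image continuous_intros Ge_cont)
      (simp add: S2_def connected_sphere)
  ultimately have "(\<lambda>p. fst (G (e p))) ` S2 = {} \<or> (\<exists>b. (\<lambda>p. fst (G (e p))) ` S2 = {b})"
    by (simp only: connected_finite_iff_sing)
  then obtain b where b: "\<And>p. p \<in> S2 \<Longrightarrow> fst (G (e p)) = b"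
    by blast
  have inj: "inj_on (\<lambda>p. snd (G (e p))) S2"
  proof (rule inj_onI)
    fix p q assume pq: "p \<in> S2" "q \<in> S2" "snd (G (e p)) = snd (G (e q))"
    then have "G (e p) = G (e q)" using b by (simp add: prod_eq_iff)
    then have "e p = e q" using GM(2) e pq by metis
    then show "p = q" using e_class pq by simp
  qed

  have "\<exists>a. homotopic_with_canon (\<lambda>_. True) S2 S2 (\<lambda>p. snd (G (e p))) (\<lambda>_. a)"
    unfolding e_def X'_def
  proof (rule fixed_sphere_nullhomotopic[OF \<epsilon> mom tor], fold X'_def)
    show "(\<lambda>C. snd (G C)) \<in> points X' \<rightarrow> S2"
      using GM(1) by (force simp: M_set_def)
    show "continuous_on (patch X' i) (\<lambda>x. snd (G (glue X' i x)))" for i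
      by (intro continuous_intros G_cont)
    show "snd (G (act X' s C)) = snd (G C)" if "s \<in> S1" "C \<in> points X'" for s C
      by (simp add: G_act[OF that] act_M_def case_prod_unfold)
  qed
  then show False
    using injective_sphere_map_not_nullhomotopic inj by blast
qed

theorem lemma2p3:
  fixes \<epsilon> :: real
    and \<mu>\<^sub>N :: "R3 \<times> R3 \<Rightarrow> real"
    and \<Psi> :: "R3 \<times> R3 \<Rightarrow> (real \<times> complex) \<times> R3"
  assumes "\<epsilon> > 0"
    and "momentum_map N_set (omega_N \<epsilon>) diag_act \<mu>\<^sub>N"
    and "toric_identification \<epsilon> \<mu>\<^sub>N \<Psi>"
  shows "\<not> equivariantly_symplectomorphic (M_mfd \<epsilon> \<mu>\<^sub>N) (M'_mfd \<epsilon> \<mu>\<^sub>N \<Psi>) \<and>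
         \<not> mu_S1_diffeomorphic (M_mfd \<epsilon> \<mu>\<^sub>N) (M'_mfd \<epsilon> \<mu>\<^sub>N \<Psi>)"
  using no_equivariant_diffeomorphism[OF assms]
  unfolding equivariantly_symplectomorphic_def mu_S1_diffeomorphic_def symplectomorphism_def
  by blast

end
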